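(* In quasi-set theory $\mathcal{Q}$: for every $m$-atom $u$, $qc(u^{*})=_E 1$, where $u^{*}$ is as defined in the context.
   Context: Quasi-set theory $\mathcal{Q}$ is a first-order theory in classical logic with no primitive equality symbol. Primitive symbols: unary predicates $m$ ("$x$ is an $m$-atom"), $M$ ("$x$ is an $M$-atom"), $Z$ ("$x$ is a set"); binary predicates $\equiv$ (indistinguishability) and $\in$; a unary function symbol $qc$ (quasi-cardinal). Abbreviations: $Q(x):=\neg(m(x)\vee M(x))$ ("$x$ is a qset"); $D(x):=M(x)\vee Z(x)$; $E(x):=Q(x)\wedge\forall y(y\in x\Rightarrow Q(y))$; $x=_E y:=(Q(x)\wedge Q(y)\wedge\forall z(z\in x\Leftrightarrow z\in y))\vee(M(x)\wedge M(y)\wedge\forall z(Q(z)\Rightarrow(x\in z\Leftrightarrow y\in z)))$ (extensional identity), $x\neq_E y:=\neg(x=_E y)$; $x\subseteq y:=\forall z(z\in x\Rightarrow z\in y)$; $x\subset y:=x\subseteq y\wedge x\neq_E y$; $\forall_Q,\exists_Q,\forall_D$ are quantifiers relativized to $Q$, $D$. Axioms of $\mathcal{Q}$: (Q1)–(Q3) $\equiv$ is reflexive, symmetric and transitive. (Q4) $\forall x\forall y(x=_E y\Rightarrow(A(x,x)\Rightarrow A(x,y)))$ for every formula $A$, with $A(x,y)$ obtained by replacing some free occurrences of $x$ by $y$, $y$ free for $x$. (Q5) $\forall x\,\neg(m(x)\wedge M(x))$. (Q6) $\forall x\forall y(x\in y\Rightarrow Q(y))$. (Q7) $\forall x(Z(x)\Rightarrow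 Q(x))$. (Q8) $\forall_Q x(\forall y(y\in x\Rightarrow D(y))\Leftrightarrow Z(x))$. (Q9) $\forall x\forall y(m(x)\wedge x\equiv y\Rightarrow m(y))$, $\forall x\forall y(x=_E y\wedge M(x)\Rightarrow M(y))$, $\forall x\forall y(x=_E y\wedge Z(x)\Rightarrow Z(y))$. (Q10) $\exists_Q x\forall y\,\neg(y\in x)$; such a qset is written $\emptyset$. (Q11) $\forall_D x\forall_D y(x\equiv y\Rightarrow x=_E y)$. (Q12) $\forall x\forall y\exists_Q z\forall t(t\in z\Leftrightarrow t\equiv x\vee t\equiv y)$; this qset is written $[x,y]$, and $[x]:=[x,x]$. (Q13) Separation: for each formula $A(t)$ without $y$ free, $\forall_Q x\exists_Q y\forall t(t\in y\Leftrightarrow t\in x\wedge A(t))$; written $[t\in x:A(t)]$. (Q14) $\forall_Q x(E(x)\Rightarrow\exists_Q y\forall z(z\in y\Leftrightarrow\exists t(z\in t\wedge t\in x)))$; written $\bigcup_{t\in x}t$. For qsets $x,y$, $x\cup y$, $x\cap y$, $x-y$ denote the qsets whose elements are exactly the objects in $x$ or in $y$, in both, in $x$ but not in $y$, respectively. (Q15) $\forall_Q x\exists_Q y\forall t(t\in y\Leftrightarrow t\subseteq x)$; written $\mathcal{P}(x)$. Also $\langle x,y\rangle:=[[x],[x,y]]$. (Q16) $\exists_Q x(\emptyset\in x\wedge\forall y(y\in x\wedge Q(y)\Rightarrow y\cup[y]\in x))$. (Q17) $\forall_Q x(E(x)\wedge x\neq_E\emptyset\Rightarrow\exists_Q y(y\in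 x\wedge y\cap x=_E\emptyset))$. The objects satisfying $D$ (with $\in$ and $=_E$) form a copy of ZFU set theory inside $\mathcal{Q}$; in it cardinals, natural numbers ($0,1,\dots$), cardinal arithmetic ($+,\le,<,2^\kappa$) and the cardinal $card(x)$ of a set are defined as usual; $Fin(x)$ means $qc(x)$ is a natural number. (Q18) $\forall x(\neg Q(x)\Rightarrow qc(x)=_E 0)$. (Q19) for every qset $x$, $qc(x)$ is a cardinal, and if $Z(x)$ then $qc(x)=_E card(x)$. (Q20) $\forall_Q x(x\neq_E\emptyset\Rightarrow qc(x)\neq_E 0)$. (Q21) for every qset $x$ and cardinal $\beta\le qc(x)$ there is a qset $y\subseteq x$ with $qc(y)=_E\beta$. (Q22) for qsets $y\subseteq x$, $qc(y)\le qc(x)$. (Q23) for qsets, $Fin(x)\wedge x\subset y\Rightarrow qc(x)<qc(y)$. (Q24) for qsets $x,y$ with no common element, $qc(x\cup y)=_E qc(x)+qc(y)$. (Q25) $\forall_Q x(qc(\mathcal{P}(x))=_E 2^{qc(x)})$. For nonempty qsets: $Sim(x,y):=\forall z\forall t(z\in x\wedge t\in y\Rightarrow z\equiv t)$, $QSim(x,y):=Sim(x,y)\wedge qc(x)=_E qc(y)$; $x/{\equiv}$ denotes the qset of the classes $[t\in x: t\equiv s]$ for $s\in x$. (Q26) Weak extensionality: $\forall_Q x\forall_Q y\big((\forall z(z\in x/{\equiv}\Rightarrow\exists t(t\in y/{\equiv}\wedge QSim(z,t)))\wedge\forall t(t\in y/{\equiv}\Rightarrow\exists z(z\in x/{\equiv}\wedge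 QSim(t,z))))\Rightarrow x\equiv y\big)$. (Q27) Replacement: for each formula $A(x,y)$, if $\forall x\exists y A(x,y)\wedge\forall x\forall x'\forall y\forall y'(A(x,y)\wedge A(x',y')\wedge x\equiv x'\Rightarrow y\equiv y')$, then $\forall_Q u\exists_Q v\forall z(z\in v\Rightarrow\exists w(w\in u\wedge A(w,z)))$. (Q28) Choice: $\forall_Q x\big(E(x)\wedge\forall y\forall z(y\in x\wedge z\in x\Rightarrow y\cap z=_E\emptyset\wedge y\neq_E\emptyset)\Rightarrow\exists_Q u\forall y\forall v(y\in x\wedge v\in y\Rightarrow\exists_Q w(w\subseteq[v]\wedge qc(w)=_E1\wedge w\cap y\equiv w\cap u))\big)$. For a qset $x$ with $E(x)$: $\bigcap_{t\in x}t:=[z\in\bigcup_{t\in x}t:\forall s(s\in x\Rightarrow z\in s)]$. For an $m$-atom $u$: $S_u:=[s\in\mathcal{P}([u]):u\in s]$ and $u^{*}:=\bigcap_{t\in S_u}t$. *)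

theory Defs
  imports Main
begin

(* The theory is rendered by its models: a structure for its first-order language on an arbitrary
   domain 'a.  Equality of HOL on 'a is never part of the language; "the same object" is expressed
   by the defined relation =\<^sub>E only. *)

record 'a quasi_struct =
  m_atom :: "'a \<Rightarrow> bool"
  M_atom :: "'a \<Rightarrow> bool"
  is_set :: "'a \<Rightarrow> bool"
  indist :: "'a \<Rightarrow> 'a \<Rightarrow> bool"
  member :: "'a \<Rightarrow> 'a \<Rightarrow> bool"
  qcard  :: "'a \<Rightarrow> 'a"

(* Syntax of the language, needed because the schemata (Q4), (Q13), (Q27) range over its formulas
   (with parameters) and not over arbitrary HOL predicates. *)

datatype qterm = Var nat | QC qterm

datatype qformula =
    Is_m qterm
  | Is_M qterm
  | Is_Z qterm
  | Indist qterm qterm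
  | Member qterm qterm
  | Neg qformula
  | Conj qformula qformula
  | Forall nat qformula

locale quasi_structure =
  fixes S :: "'a quasi_struct"
begin

abbreviation m :: "'a \<Rightarrow> bool" where "m \<equiv> m_atom S"
abbreviation M :: "'a \<Rightarrow> bool" where "M \<equiv> M_atom S"
abbreviation Z :: "'a \<Rightarrow> bool" where "Z \<equiv> is_set S"
abbreviation ind (infix \<open>\<approx>\<close> 50) where "x \<approx> y \<equiv> indist S x y"
abbreviation mem (infix \<open>\<epsilon>\<close> 50) where "x \<epsilon> y \<equiv> member S x y"
abbreviation qc :: "'a \<Rightarrow> 'a" where "qc \<equiv> qcard S"

primrec val :: "(nat \<Rightarrow> 'a) \<Rightarrow> qterm \<Rightarrow> 'a" where
  "val e (Var i) = e i"
| "val e (QC t) = qc (val e t)"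

primrec sat :: "(nat \<Rightarrow> 'a) \<Rightarrow> qformula \<Rightarrow> bool" where
  "sat e (Is_m t) \<longleftrightarrow> m (val e t)"
| "sat e (Is_M t) \<longleftrightarrow> M (val e t)"
| "sat e (Is_Z t) \<longleftrightarrow> Z (val e t)"
| "sat e (Indist s t) \<longleftrightarrow> val e s \<approx> val e t"
| "sat e (Member s t) \<longleftrightarrow> val e s \<epsilon> val e t"
| "sat e (Neg A) \<longleftrightarrow> \<not> sat e A"
| "sat e (Conj A B) \<longleftrightarrow> sat e A \<and> sat e B"
| "sat e (Forall i A) \<longleftrightarrow> (\<forall>a. sat (e(i := a)) A)"

definition Q :: "'a \<Rightarrow> bool" where
  "Q x \<longleftrightarrow> \<not> (m x \<or> M x)"

definition D :: "'a \<Rightarrow> bool" where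
  "D x \<longleftrightarrow> M x \<or> Z x"

definition E :: "'a \<Rightarrow> bool" where
  "E x \<longleftrightarrow> Q x \<and> (\<forall>y. y \<epsilon> x \<longrightarrow> Q y)"

definition ext_eq :: "'a \<Rightarrow> 'a \<Rightarrow> bool" (infix \<open>=\<^sub>E\<close> 50) where
  "x =\<^sub>E y \<longleftrightarrow>
     (Q x \<and> Q y \<and> (\<forall>z. z \<epsilon> x \<longleftrightarrow> z \<epsilon> y)) \<or>
     (M x \<and> M y \<and> (\<forall>z. Q z \<longrightarrow> (x \<epsilon> z \<longleftrightarrow> y \<epsilon> z)))"

definition sub :: "'a \<Rightarrow> 'a \<Rightarrow> bool" (infix \<open>\<sqsubseteq>\<close> 50) where
  "x \<sqsubseteq> y \<longleftrightarrow> (\<forall>z. z \<epsilon> x \<longrightarrow> z \<epsilon> y)"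

definition psub :: "'a \<Rightarrow> 'a \<Rightarrow> bool" (infix \<open>\<sqsubset>\<close> 50) where
  "x \<sqsubset> y \<longleftrightarrow> x \<sqsubseteq> y \<and> \<not> x =\<^sub>E y"

(* "The" qset of the objects satisfying P.  It is determined up to =\<^sub>E only, so the choice of a
   representative is immaterial; the axioms provide existence wherever it is used. *)

definition compr :: "('a \<Rightarrow> bool) \<Rightarrow> 'a" where
  "compr P = (SOME y. Q y \<and> (\<forall>t. t \<epsilon> y \<longleftrightarrow> P t))"

definition empty :: 'a where "empty = compr (\<lambda>t. False)"
definition pair :: "'a \<Rightarrow> 'a \<Rightarrow> 'a" where "pair x y = compr (\<lambda>t. t \<approx> x \<or> t \<approx> y)"
definition single :: "'a \<Rightarrow> 'a" where "single x = pair x x"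
definition sep :: "'a \<Rightarrow> ('a \<Rightarrow> bool) \<Rightarrow> 'a" where "sep x P = compr (\<lambda>t. t \<epsilon> x \<and> P t)"
definition Union_of :: "'a \<Rightarrow> 'a" where "Union_of x = compr (\<lambda>z. \<exists>t. z \<epsilon> t \<and> t \<epsilon> x)"
definition cup :: "'a \<Rightarrow> 'a \<Rightarrow> 'a" where "cup x y = compr (\<lambda>t. t \<epsilon> x \<or> t \<epsilon> y)"
definition cap :: "'a \<Rightarrow> 'a \<Rightarrow> 'a" where "cap x y = compr (\<lambda>t. t \<epsilon> x \<and> t \<epsilon> y)"
definition Power :: "'a \<Rightarrow> 'a" where "Power x = compr (\<lambda>t. Q t \<and> t \<sqsubseteq> x)"
definition Inter_of :: "'a \<Rightarrow> 'a" where "Inter_of x = sep (Union_of x) (\<lambda>z. \<forall>s. s \<epsilon> x \<longrightarrow> z \<epsilon> s)"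

definition quot :: "'a \<Rightarrow> 'a" where
  "quot x = compr (\<lambda>c. \<exists>s. s \<epsilon> x \<and> c =\<^sub>E sep x (\<lambda>t. t \<approx> s))"

(* The copy of ZFU formed by the objects satisfying D.  Pairs here are the classical Kuratowski
   pairs, formed with =\<^sub>E, not the qsets pair x y, which are formed with indistinguishability. *)

definition dpair :: "'a \<Rightarrow> 'a \<Rightarrow> 'a" where
  "dpair x y = compr (\<lambda>t. t =\<^sub>E x \<or> t =\<^sub>E y)"

definition opair :: "'a \<Rightarrow> 'a \<Rightarrow> 'a" where
  "opair x y = dpair (dpair x x) (dpair x y)"

definition is_fun :: "'a \<Rightarrow> 'a \<Rightarrow> 'a \<Rightarrow> bool" where
  "is_fun f a b \<longleftrightarrow> Z f
     \<and> (\<forall>p. p \<epsilon> f \<longrightarrow> (\<exists>x y. x \<epsilon> a \<and> y \<epsilon> b \<and> p =\<^sub>E opair x y))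
     \<and> (\<forall>x. x \<epsilon> a \<longrightarrow> (\<exists>y. y \<epsilon> b \<and> opair x y \<epsilon> f
            \<and> (\<forall>y'. y' \<epsilon> b \<and> opair x y' \<epsilon> f \<longrightarrow> y' =\<^sub>E y)))"

definition bijection :: "'a \<Rightarrow> 'a \<Rightarrow> 'a \<Rightarrow> bool" where
  "bijection f a b \<longleftrightarrow> is_fun f a b
     \<and> (\<forall>y. y \<epsilon> b \<longrightarrow> (\<exists>x. x \<epsilon> a \<and> opair x y \<epsilon> f
            \<and> (\<forall>x'. x' \<epsilon> a \<and> opair x' y \<epsilon> f \<longrightarrow> x' =\<^sub>E x)))"

definition equinum :: "'a \<Rightarrow> 'a \<Rightarrow> bool" where
  "equinum a b \<longleftrightarrow> (\<exists>f. bijection f a b)"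

definition ordinal :: "'a \<Rightarrow> bool" where
  "ordinal a \<longleftrightarrow> Z a
     \<and> (\<forall>x. x \<epsilon> a \<longrightarrow> Z x \<and> x \<sqsubseteq> a)
     \<and> (\<forall>x. x \<epsilon> a \<longrightarrow> \<not> x \<epsilon> x)
     \<and> (\<forall>x y z. x \<epsilon> a \<and> y \<epsilon> a \<and> z \<epsilon> a \<and> x \<epsilon> y \<and> y \<epsilon> z \<longrightarrow> x \<epsilon> z)
     \<and> (\<forall>x y. x \<epsilon> a \<and> y \<epsilon> a \<longrightarrow> x \<epsilon> y \<or> x =\<^sub>E y \<or> y \<epsilon> x)
     \<and> (\<forall>s. Z s \<and> s \<sqsubseteq> a \<and> \<not> s =\<^sub>E empty \<longrightarrow>
            (\<exists>x. x \<epsilon> s \<and> (\<forall>y. y \<epsilon> s \<longrightarrow> x =\<^sub>E y \<or> x \<epsilon> y)))"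

definition cardinal :: "'a \<Rightarrow> bool" where
  "cardinal k \<longleftrightarrow> ordinal k \<and> (\<forall>a. a \<epsilon> k \<longrightarrow> \<not> equinum a k)"

definition card_less :: "'a \<Rightarrow> 'a \<Rightarrow> bool" where
  "card_less k l \<longleftrightarrow> k \<epsilon> l"

definition card_le :: "'a \<Rightarrow> 'a \<Rightarrow> bool" where
  "card_le k l \<longleftrightarrow> k \<epsilon> l \<or> k =\<^sub>E l"

definition dsuc :: "'a \<Rightarrow> 'a" where
  "dsuc x = compr (\<lambda>t. t \<epsilon> x \<or> t =\<^sub>E x)"

abbreviation zero :: 'a where "zero \<equiv> empty"
definition one :: 'a where "one = dsuc zero"
definition two :: 'a where "two = dsuc one"

definition natural :: "'a \<Rightarrow> bool" where
  "natural n \<longleftrightarrow> ordinal n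
     \<and> (\<forall>b. card_le b n \<longrightarrow> b =\<^sub>E zero \<or> (\<exists>c. c \<epsilon> b \<and> b =\<^sub>E dsuc c))"

(* has_card x c: card(x) = c;  card_sum k l c: k + l = c;  card_exp2 k c: 2^k = c. *)

definition has_card :: "'a \<Rightarrow> 'a \<Rightarrow> bool" where
  "has_card x c \<longleftrightarrow> cardinal c \<and> equinum x c"

definition card_sum :: "'a \<Rightarrow> 'a \<Rightarrow> 'a \<Rightarrow> bool" where
  "card_sum k l c \<longleftrightarrow>
     (\<exists>a b. Z a \<and> Z b \<and> \<not> (\<exists>t. t \<epsilon> a \<and> t \<epsilon> b) \<and> equinum a k \<and> equinum b l \<and> has_card (cup a b) c)"

definition card_exp2 :: "'a \<Rightarrow> 'a \<Rightarrow> bool" where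
  "card_exp2 k c \<longleftrightarrow> (\<exists>p. Z p \<and> (\<forall>f. f \<epsilon> p \<longleftrightarrow> is_fun f k two) \<and> has_card p c)"

definition Fin :: "'a \<Rightarrow> bool" where
  "Fin x \<longleftrightarrow> natural (qc x)"

definition Sim :: "'a \<Rightarrow> 'a \<Rightarrow> bool" where
  "Sim x y \<longleftrightarrow> (\<forall>z t. z \<epsilon> x \<and> t \<epsilon> y \<longrightarrow> z \<approx> t)"

definition QSim :: "'a \<Rightarrow> 'a \<Rightarrow> bool" where
  "QSim x y \<longleftrightarrow> Sim x y \<and> qc x =\<^sub>E qc y"

definition S_of :: "'a \<Rightarrow> 'a" where
  "S_of u = sep (Power (single u)) (\<lambda>s. u \<epsilon> s)"

definition star :: "'a \<Rightarrow> 'a" where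
  "star u = Inter_of (S_of u)"

end

(* All axioms but (Q15) and (Q25). *)

locale quasi_set_core = quasi_structure S for S :: "'a quasi_struct" +
  assumes Q1: "x \<approx> x"
    and Q2: "x \<approx> y \<Longrightarrow> y \<approx> x"
    and Q3: "x \<approx> y \<Longrightarrow> y \<approx> z \<Longrightarrow> x \<approx> z"
    (* in A, the variable j marks the occurrences of x (variable i) that are replaced by y *)
    and Q4: "i \<noteq> j \<Longrightarrow> x =\<^sub>E y \<Longrightarrow> sat (e(i := x, j := x)) A \<Longrightarrow> sat (e(i := x, j := y)) A"
    and Q5: "\<not> (m x \<and> M x)"
    and Q6: "x \<epsilon> y \<Longrightarrow> Q y"
    and Q7: "Z x \<Longrightarrow> Q x"
    and Q8: "Q x \<Longrightarrow> (\<forall>y. y \<epsilon> x \<longrightarrow> D y) \<longleftrightarrow> Z x"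
    and Q9_m: "m x \<and> x \<approx> y \<Longrightarrow> m y"
    and Q9_M: "x =\<^sub>E y \<and> M x \<Longrightarrow> M y"
    and Q9_Z: "x =\<^sub>E y \<and> Z x \<Longrightarrow> Z y"
    and Q10: "\<exists>x. Q x \<and> (\<forall>y. \<not> y \<epsilon> x)"
    and Q11: "D x \<Longrightarrow> D y \<Longrightarrow> x \<approx> y \<Longrightarrow> x =\<^sub>E y"
    and Q12: "\<exists>z. Q z \<and> (\<forall>t. t \<epsilon> z \<longleftrightarrow> t \<approx> x \<or> t \<approx> y)"
    and Q13: "Q x \<Longrightarrow> \<exists>y. Q y \<and> (\<forall>t. t \<epsilon> y \<longleftrightarrow> t \<epsilon> x \<and> sat (e(i := t)) A)"
    and Q14: "Q x \<Longrightarrow> E x \<Longrightarrow> \<exists>y. Q y \<and> (\<forall>z. z \<epsilon> y \<longleftrightarrow> (\<exists>t. z \<epsilon> t \<and> t \<epsilon> x))"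
    and Q16: "\<exists>x. Q x \<and> empty \<epsilon> x \<and> (\<forall>y. y \<epsilon> x \<and> Q y \<longrightarrow> cup y (single y) \<epsilon> x)"
    and Q17: "Q x \<Longrightarrow> E x \<and> \<not> x =\<^sub>E empty \<Longrightarrow> \<exists>y. Q y \<and> y \<epsilon> x \<and> cap y x =\<^sub>E empty"
    and Q18: "\<not> Q x \<Longrightarrow> qc x =\<^sub>E zero"
    and Q19: "Q x \<Longrightarrow> cardinal (qc x) \<and> (Z x \<longrightarrow> has_card x (qc x))"
    and Q20: "Q x \<Longrightarrow> \<not> x =\<^sub>E empty \<Longrightarrow> \<not> qc x =\<^sub>E zero"
    and Q21: "Q x \<Longrightarrow> cardinal b \<Longrightarrow> card_le b (qc x) \<Longrightarrow> \<exists>y. Q y \<and> y \<sqsubseteq> x \<and> qc y =\<^sub>E b"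
    and Q22: "Q x \<Longrightarrow> Q y \<Longrightarrow> y \<sqsubseteq> x \<Longrightarrow> card_le (qc y) (qc x)"
    and Q23: "Q x \<Longrightarrow> Q y \<Longrightarrow> Fin x \<and> x \<sqsubset> y \<Longrightarrow> card_less (qc x) (qc y)"
    and Q24: "Q x \<Longrightarrow> Q y \<Longrightarrow> \<not> (\<exists>t. t \<epsilon> x \<and> t \<epsilon> y) \<Longrightarrow> card_sum (qc x) (qc y) (qc (cup x y))"
    and Q26: "Q x \<Longrightarrow> Q y \<Longrightarrow>
        (\<forall>z. z \<epsilon> quot x \<longrightarrow> (\<exists>t. t \<epsilon> quot y \<and> QSim z t)) \<and>
        (\<forall>t. t \<epsilon> quot y \<longrightarrow> (\<exists>z. z \<epsilon> quot x \<and> QSim t z)) \<Longrightarrow> x \<approx> y"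
    and Q27: "i \<noteq> j \<Longrightarrow>
        (\<forall>x. \<exists>y. sat (e(i := x, j := y)) A) \<and>
        (\<forall>x x' y y'. sat (e(i := x, j := y)) A \<and> sat (e(i := x', j := y')) A \<and> x \<approx> x' \<longrightarrow> y \<approx> y') \<Longrightarrow>
        Q u \<Longrightarrow> \<exists>v. Q v \<and> (\<forall>z. z \<epsilon> v \<longrightarrow> (\<exists>w. w \<epsilon> u \<and> sat (e(i := w, j := z)) A))"
    and Q28: "Q x \<Longrightarrow>
        E x \<and> (\<forall>y z. y \<epsilon> x \<and> z \<epsilon> x \<longrightarrow> cap y z =\<^sub>E empty \<and> \<not> y =\<^sub>E empty) \<Longrightarrow>
        \<exists>u. Q u \<and> (\<forall>y v. y \<epsilon> x \<and> v \<epsilon> y \<longrightarrow>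
          (\<exists>w. Q w \<and> w \<sqsubseteq> single v \<and> qc w =\<^sub>E one \<and> cap w y \<approx> cap w u))"

locale quasi_set_theory = quasi_set_core S for S :: "'a quasi_struct" +
  assumes Q15: "Q x \<Longrightarrow> \<exists>y. Q y \<and> (\<forall>t. t \<epsilon> y \<longleftrightarrow> Q t \<and> t \<sqsubseteq> x)"
    and Q25: "Q x \<Longrightarrow> card_exp2 (qc x) (qc (Power x))"

(* With Q t dropped from (Q15), i.e. if Power x is to contain everything that satisfies t \<sqsubseteq> x,
   every atom belongs to every power qset (atoms have no elements), and then (Q25) at the empty qset
   refutes the existence of atoms.  The remainder shows that the axioms so read imply
   quasi_set_theory, so that nothing is lost by the guard. *)

context quasi_set_core begin

lemma eq_refl: "Q x \<Longrightarrow> x =\<^sub>E x" by (simp add: ext_eq_def)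
lemma eq_sym: "x =\<^sub>E y \<Longrightarrow> y =\<^sub>E x" by (auto simp add: ext_eq_def)
lemma eq_trans: "x =\<^sub>E y \<Longrightarrow> y =\<^sub>E z \<Longrightarrow> x =\<^sub>E z" by (auto simp add: ext_eq_def Q_def)
lemma eq_ind: assumes "x =\<^sub>E y" shows "x \<approx> y"
  using Q4[where i=0 and j=1 and A="Indist (Var 0) (Var 1)", OF _ assms] Q1 by simp
lemma eq_memL: assumes "x =\<^sub>E y" "x \<epsilon> z" shows "y \<epsilon> z"
  using Q4[where i=0 and j=1 and A="Member (Var 1) (Var 2)" and e="\<lambda>_. z", OF _ assms(1)] assms(2) by simp
lemma eq_memR: assumes "x =\<^sub>E y" "z \<epsilon> x" shows "z \<epsilon> y"
  using Q4[where i=0 and j=1 and A="Member (Var 2) (Var 1)" and e="\<lambda>_. z", OF _ assms(1)] assms(2) by simp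
lemma extI: "Q x \<Longrightarrow> Q y \<Longrightarrow> (\<And>z. z \<epsilon> x \<longleftrightarrow> z \<epsilon> y) \<Longrightarrow> x =\<^sub>E y" by (simp add: ext_eq_def)

lemma comprI: assumes "\<exists>y. Q y \<and> (\<forall>t. t \<epsilon> y \<longleftrightarrow> P t)"
  shows "Q (compr P) \<and> (\<forall>t. t \<epsilon> compr P \<longleftrightarrow> P t)"
  unfolding compr_def using someI_ex[OF assms] by blast

abbreviation "Imp A B \<equiv> Neg (Conj A (Neg B))"
abbreviation "Or A B \<equiv> Neg (Conj (Neg A) (Neg B))"
abbreviation "Iff A B \<equiv> Conj (Imp A B) (Imp B A)"
abbreviation "QF t \<equiv> Conj (Neg (Is_m t)) (Neg (Is_M t))"
definition "EqF = Or (Conj (QF (Var 0)) (Conj (QF (Var 1)) (Forall 9 (Iff (Member (Var 9) (Var 0)) (Member (Var 9) (Var 1))))))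
  (Conj (Is_M (Var 0)) (Conj (Is_M (Var 1)) (Forall 9 (Imp (QF (Var 9)) (Iff (Member (Var 0) (Var 9)) (Member (Var 1) (Var 9)))))))"
lemma sat_EqF: "sat e EqF \<longleftrightarrow> e 0 =\<^sub>E e 1"
  by (auto simp add: EqF_def ext_eq_def Q_def)

lemma empty_mem: "Q empty" "\<not> t \<epsilon> empty"
  using comprI[of "\<lambda>_. False"] Q10 by (auto simp: empty_def)
lemma pair_mem: "Q (pair x y)" "t \<epsilon> pair x y \<longleftrightarrow> t \<approx> x \<or> t \<approx> y"
  using comprI[OF Q12[of x y]] by (auto simp: pair_def)
lemma single_mem: "Q (single x)" "t \<epsilon> single x \<longleftrightarrow> t \<approx> x"
  using pair_mem by (auto simp: single_def)
lemma sep_mem: assumes "Q x" "\<And>t. P t \<longleftrightarrow> sat (e(i:=t)) A"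
  shows "Q (sep x P)" "t \<epsilon> sep x P \<longleftrightarrow> t \<epsilon> x \<and> P t"
  using comprI[of "\<lambda>t. t \<epsilon> x \<and> P t"] Q13[OF assms(1), of e i A] assms(2) by (auto simp: sep_def)

lemma Z_empty: "Z empty" using Q8[OF empty_mem(1)] empty_mem by blast

lemma one_mem: "Q one" "t \<epsilon> one \<longleftrightarrow> t =\<^sub>E zero"
proof -
  have "\<exists>y. Q y \<and> (\<forall>t. t \<epsilon> y \<longleftrightarrow> t \<epsilon> single zero \<and> sat ((\<lambda>_. zero)(0:=t)) EqF)"
    by (rule Q13[OF single_mem(1)])
  hence "\<exists>y. Q y \<and> (\<forall>t. t \<epsilon> y \<longleftrightarrow> t \<epsilon> zero \<or> t =\<^sub>E zero)"
    using eq_ind by (simp add: sat_EqF single_mem empty_mem) blast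
  from comprI[OF this] show "Q one" "t \<epsilon> one \<longleftrightarrow> t =\<^sub>E zero" by (auto simp: one_def dsuc_def empty_mem)
qed

lemma Z_one: "Z one"
  using Q8[OF one_mem(1)] one_mem(2) Q9_Z eq_sym Z_empty unfolding D_def by blast

lemma one_neq_zero: "\<not> one =\<^sub>E zero" "\<not> zero =\<^sub>E one"
  using eq_memR[of one zero zero] eq_sym one_mem(2)[of zero] empty_mem eq_refl by blast+

lemma eq_zeroI: "Q x \<Longrightarrow> (\<And>t. \<not> t \<epsilon> x) \<Longrightarrow> x =\<^sub>E zero"
  by (rule extI) (simp_all add: empty_mem)

lemma not_mem_eq_zero: "x =\<^sub>E zero \<Longrightarrow> \<not> t \<epsilon> x"
  using eq_memR[of x zero t] empty_mem(2) by blast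

lemma zero_in_one: "zero \<epsilon> one"
  using one_mem(2)[of zero] eq_refl[OF empty_mem(1)] by blast

lemma mem_one_empty: "x \<epsilon> one \<Longrightarrow> \<not> t \<epsilon> x"
  using one_mem(2)[of x] not_mem_eq_zero by blast

lemma equinum_empty: "equinum a b \<Longrightarrow> (\<And>t. \<not> t \<epsilon> a) \<Longrightarrow> \<not> y \<epsilon> b"
  unfolding equinum_def bijection_def by blast

lemma ordinalD:
  assumes "ordinal a"
  shows "Z a" "\<forall>x. x \<epsilon> a \<longrightarrow> Z x \<and> x \<sqsubseteq> a" "\<forall>x. x \<epsilon> a \<longrightarrow> \<not> x \<epsilon> x"
    "\<forall>x y z. x \<epsilon> a \<and> y \<epsilon> a \<and> z \<epsilon> a \<and> x \<epsilon> y \<and> y \<epsilon> z \<longrightarrow> x \<epsilon> z"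
    "\<forall>s. Z s \<and> s \<sqsubseteq> a \<and> \<not> s =\<^sub>E empty \<longrightarrow>
            (\<exists>x. x \<epsilon> s \<and> (\<forall>y. y \<epsilon> s \<longrightarrow> x =\<^sub>E y \<or> x \<epsilon> y))"
  using assms unfolding ordinal_def by - (elim conjE, assumption)+

lemma ordinal_Z: "ordinal a \<Longrightarrow> Z a"
  by (rule ordinalD(1))

lemma ordinal_mem_Z: "ordinal a \<Longrightarrow> x \<epsilon> a \<Longrightarrow> Z x"
  using ordinalD(2)[of a] by blast

lemma ordinal_mem_mem: "ordinal a \<Longrightarrow> x \<epsilon> a \<Longrightarrow> t \<epsilon> x \<Longrightarrow> t \<epsilon> a"
  using ordinalD(2)[of a] unfolding sub_def by blast

lemma ordinal_irrefl: "ordinal a \<Longrightarrow> x \<epsilon> a \<Longrightarrow> \<not> x \<epsilon> x"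
  using ordinalD(3)[of a] by blast

lemma ordinal_trans: "ordinal a \<Longrightarrow> x \<epsilon> a \<Longrightarrow> y \<epsilon> a \<Longrightarrow> z \<epsilon> a \<Longrightarrow> x \<epsilon> y \<Longrightarrow> y \<epsilon> z \<Longrightarrow> x \<epsilon> z"
  using ordinalD(4)[of a] by blast

lemma ordinal_least:
  assumes "ordinal a" "Z s" "\<And>t. t \<epsilon> s \<Longrightarrow> t \<epsilon> a" "\<not> s =\<^sub>E zero"
  shows "\<exists>x. x \<epsilon> s \<and> (\<forall>y. y \<epsilon> s \<longrightarrow> x =\<^sub>E y \<or> x \<epsilon> y)"
proof -
  have "s \<sqsubseteq> a" using assms(3) by (simp add: sub_def)
  with ordinalD(5)[OF assms(1)] assms(2,4) show ?thesis by blast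
qed

lemma qc_empty: "qc empty =\<^sub>E zero"
proof (rule eq_zeroI)
  have "has_card empty (qc empty)" using Q19[OF empty_mem(1)] Z_empty by blast
  then have c: "ordinal (qc empty)" "equinum empty (qc empty)"
    by (simp_all add: has_card_def cardinal_def)
  show "Q (qc empty)" by (rule Q7[OF ordinal_Z[OF c(1)]])
  show "\<not> t \<epsilon> qc empty" for t by (rule equinum_empty[OF c(2) empty_mem(2)])
qed

lemma one_card_le:
  assumes o: "ordinal k" and nz: "\<not> k =\<^sub>E zero"
  shows "card_le one k \<and> zero \<epsilon> k"
proof -
  have Qk: "Q k" by (rule Q7[OF ordinal_Z[OF o]])
  obtain x where x: "x \<epsilon> k" "\<And>y. y \<epsilon> k \<Longrightarrow> x =\<^sub>E y \<or> x \<epsilon> y"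
    using ordinal_least[OF o ordinal_Z[OF o] _ nz] by blast
  have "x =\<^sub>E zero"
  proof (rule eq_zeroI)
    show "Q x" by (rule Q7[OF ordinal_mem_Z[OF o x(1)]])
    fix t
    show "\<not> t \<epsilon> x"
    proof
      assume t: "t \<epsilon> x"
      have tk: "t \<epsilon> k" by (rule ordinal_mem_mem[OF o x(1) t])
      from x(2)[OF tk] show False
      proof
        assume "x =\<^sub>E t"
        then have "t \<epsilon> t" using t by (rule eq_memR)
        then show False using ordinal_irrefl[OF o tk] by simp
      next
        assume "x \<epsilon> t"
        then have "x \<epsilon> x" using ordinal_trans[OF o x(1) tk x(1)] t by simp
        then show False using ordinal_irrefl[OF o x(1)] by simp
      qed
    qed
  qed
  then have zk: "zero \<epsilon> k" using x(1) by (rule eq_memL)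
  let ?P = "\<lambda>t. \<not> t =\<^sub>E zero" let ?s = "sep k ?P"
  have s: "Q ?s" "\<And>t. t \<epsilon> ?s \<longleftrightarrow> t \<epsilon> k \<and> ?P t"
    using sep_mem[OF Qk, of ?P "\<lambda>_. zero" 0 "Neg EqF"] by (simp_all add: sat_EqF)
  have Zs: "Z ?s"
  proof -
    have "\<forall>y. y \<epsilon> k \<longrightarrow> D y" using Q8[OF Qk] ordinal_Z[OF o] by simp
    then show ?thesis using Q8[OF s(1)] s(2) by simp
  qed
  have "card_le one k"
  proof (cases "?s =\<^sub>E zero")
    case True
    have "t \<epsilon> one \<longleftrightarrow> t \<epsilon> k" for t
    proof
      assume "t \<epsilon> one"
      then have "zero =\<^sub>E t" using one_mem(2) eq_sym by simp
      then show "t \<epsilon> k" using zk by (rule eq_memL)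
    next
      assume "t \<epsilon> k"
      then have "t =\<^sub>E zero" using s(2)[of t] not_mem_eq_zero[OF True, of t] by simp
      then show "t \<epsilon> one" by (simp add: one_mem(2))
    qed
    then have "one =\<^sub>E k" by (rule extI[OF one_mem(1) Qk])
    then show ?thesis by (simp add: card_le_def)
  next
    case False
    then obtain b where b: "b \<epsilon> ?s" "\<And>y. y \<epsilon> ?s \<Longrightarrow> b =\<^sub>E y \<or> b \<epsilon> y"
      using ordinal_least[OF o Zs _ False] s(2) by blast
    have bk: "b \<epsilon> k" "\<not> b =\<^sub>E zero" using b(1) s(2)[of b] by simp_all
    have Qb: "Q b" by (rule Q7[OF ordinal_mem_Z[OF o bk(1)]])
    have A: "t =\<^sub>E zero" if t: "t \<epsilon> b" for t
    proof (rule ccontr)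
      assume n: "\<not> t =\<^sub>E zero"
      have tk: "t \<epsilon> k" by (rule ordinal_mem_mem[OF o bk(1) t])
      then have "t \<epsilon> ?s" using s(2) n by simp
      from b(2)[OF this] show False
      proof
        assume "b =\<^sub>E t"
        then have "t \<epsilon> t" using t by (rule eq_memR)
        then show False using ordinal_irrefl[OF o tk] by simp
      next
        assume "b \<epsilon> t"
        then have "b \<epsilon> b" using ordinal_trans[OF o bk(1) tk bk(1)] t by simp
        then show False using ordinal_irrefl[OF o bk(1)] by simp
      qed
    qed
    obtain t where t: "t \<epsilon> b" using eq_zeroI[OF Qb] bk(2) by blast
    have zb: "zero \<epsilon> b" by (rule eq_memL[OF A[OF t] t])
    have "z \<epsilon> b \<longleftrightarrow> z \<epsilon> one" for z
      using A[of z] zb eq_memL[OF eq_sym, of z zero b] by (auto simp: one_mem(2))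
    then have "b =\<^sub>E one" by (rule extI[OF Qb one_mem(1)])
    then show ?thesis using eq_memL[OF _ bk(1)] by (simp add: card_le_def)
  qed
  with zk show ?thesis by simp
qed

lemma opair_cong: "x =\<^sub>E x' \<Longrightarrow> opair x y = opair x' y"
proof -
  assume x: "x =\<^sub>E x'"
  have "t =\<^sub>E x \<longleftrightarrow> t =\<^sub>E x'" for t
    using eq_trans[OF _ x] eq_trans[OF _ eq_sym[OF x]] by blast
  then show ?thesis by (simp add: opair_def dpair_def)
qed

lemma equinum_uniq:
  assumes eq: "equinum a k" and a: "\<And>t. t \<epsilon> a \<Longrightarrow> t =\<^sub>E zero" and y: "y \<epsilon> k" and y': "y' \<epsilon> k"
  shows "y =\<^sub>E y'"
proof -
  from eq obtain g where g: "bijection g a k" unfolding equinum_def by blast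
  from g y obtain x where x: "x \<epsilon> a" "opair x y \<epsilon> g" unfolding bijection_def by blast
  from g y' obtain x' where x': "x' \<epsilon> a" "opair x' y' \<epsilon> g" unfolding bijection_def by blast
  have "x' =\<^sub>E x" by (rule eq_trans[OF a[OF x'(1)] eq_sym[OF a[OF x(1)]]])
  then have xy': "opair x y' \<epsilon> g" using x'(2) opair_cong by simp
  from g x(1) obtain z where z: "\<And>w. w \<epsilon> k \<Longrightarrow> opair x w \<epsilon> g \<Longrightarrow> w =\<^sub>E z"
    unfolding bijection_def is_fun_def by blast
  show ?thesis by (rule eq_trans[OF z[OF y x(2)] eq_sym[OF z[OF y' xy']]])
qed

lemma no_atoms:
  assumes P: "Q P0" "\<And>t. t \<epsilon> P0 \<longleftrightarrow> t \<sqsubseteq> empty" and ex: "card_exp2 (qc empty) (qc P0)"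
  shows "Q a"
proof (rule ccontr)
  assume a: "\<not> Q a"
  define c where "c = qc one"
  have c: "ordinal c" "equinum one c"
    using Q19[OF one_mem(1)] Z_one by (simp_all add: has_card_def cardinal_def c_def)
  have c0: "\<not> c =\<^sub>E zero"
    unfolding c_def by (rule Q20[OF one_mem(1) one_neq_zero(1)])
  have c1: "card_le one c" and zc: "zero \<epsilon> c" using one_card_le[OF c(1) c0] by simp_all
  have all: "b =\<^sub>E zero" if "b \<epsilon> c" for b
    by (rule equinum_uniq[OF c(2) _ that zc]) (simp add: one_mem(2))
  have ce: "c =\<^sub>E one"
    using c1 all[of one] one_neq_zero(1) eq_sym[of one c] by (auto simp: card_le_def)
  have "natural c" unfolding natural_def
  proof (intro conjI allI impI c(1))
    fix b assume "card_le b c"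
    then consider "b \<epsilon> c" | "b =\<^sub>E c" unfolding card_le_def by blast
    then show "b =\<^sub>E zero \<or> (\<exists>c. c \<epsilon> b \<and> b =\<^sub>E dsuc c)"
    proof cases
      case 1
      then show ?thesis using all by blast
    next
      case 2
      have "zero \<epsilon> b" by (rule eq_memR[OF eq_sym[OF 2] zc])
      moreover have "b =\<^sub>E dsuc zero" using eq_trans[OF 2 ce] by (simp add: one_def)
      ultimately show ?thesis by blast
    qed
  qed
  then have F: "Fin one" by (simp add: Fin_def c_def)
  have "one \<sqsubseteq> P0" using P(2) mem_one_empty by (simp add: sub_def)
  moreover have "\<not> one =\<^sub>E P0"
  proof
    assume e: "one =\<^sub>E P0"
    have "a \<epsilon> P0" using P(2) Q6 a by (auto simp: sub_def)
    then have "a \<epsilon> one" by (rule eq_memR[OF eq_sym[OF e]])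
    then have "a =\<^sub>E zero" by (simp add: one_mem(2))
    then show False using a empty_mem(1) by (auto simp: ext_eq_def Q_def)
  qed
  ultimately have "card_less c (qc P0)"
    using Q23[OF one_mem(1) P(1)] F by (simp add: psub_def c_def)
  then have ck: "c \<epsilon> qc P0" by (simp add: card_less_def)
  obtain p where p: "\<And>f. f \<epsilon> p \<Longrightarrow> is_fun f (qc zero) two" "equinum p (qc P0)"
    using ex unfolding card_exp2_def has_card_def by blast
  have ok: "ordinal (qc P0)" using Q19[OF P(1)] by (simp add: cardinal_def)
  have zk: "zero \<epsilon> qc P0" by (rule ordinal_mem_mem[OF ok ck zc])
  have p0: "f =\<^sub>E zero" if f: "f \<epsilon> p" for f
  proof (rule eq_zeroI)
    show "Q f" using p(1)[OF f] Q7 by (simp add: is_fun_def)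
    show "\<not> t \<epsilon> f" for t
      using p(1)[OF f] not_mem_eq_zero[OF qc_empty] unfolding is_fun_def by blast
  qed
  have "c =\<^sub>E zero" by (rule equinum_uniq[OF p(2) p0 ck zk])
  then show False using c0 by simp
qed

end

locale quasi_set_theory_unguarded = quasi_set_core S for S :: "'a quasi_struct" +
  assumes Q15_unguarded: "Q x \<Longrightarrow> \<exists>y. Q y \<and> (\<forall>t. t \<epsilon> y \<longleftrightarrow> t \<sqsubseteq> x)"
    and Q25_unguarded: "Q x \<Longrightarrow> card_exp2 (qc x) (qc (compr (\<lambda>t. t \<sqsubseteq> x)))"
begin

lemma no_atoms_unguarded: "Q a"
proof (rule no_atoms)
  show "Q (compr (\<lambda>t. t \<sqsubseteq> empty))" "t \<epsilon> compr (\<lambda>t. t \<sqsubseteq> empty) \<longleftrightarrow> t \<sqsubseteq> empty" for t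
    using comprI[OF Q15_unguarded[OF empty_mem(1)]] by simp_all
  show "card_exp2 (qc empty) (qc (compr (\<lambda>t. t \<sqsubseteq> empty)))"
    by (rule Q25_unguarded[OF empty_mem(1)])
qed

sublocale quasi_set_theory
  by unfold_locales
    (use Q15_unguarded Q25_unguarded no_atoms_unguarded in \<open>simp_all add: Power_def\<close>)

end

end

theory Submission
  imports Defs
begin

text \<open>The qset u* lies inside every qset x with u \<in> x \<subseteq> [u]. It contains u, so its quasi-cardinal is
  at least 1, and (Q21) gives y \<subseteq> u* of quasi-cardinal 1. If u were not in y, then u* \<subseteq> [u] - y, so y
  would be empty. Hence u \<in> y, so u* \<subseteq> y, that is, u* = y.\<close>

context quasi_set_core
begin

lemma qc_Q: "Q x \<Longrightarrow> Q (qc x)"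
  using Q19 by (auto simp: cardinal_def intro: Q7 ordinal_Z)

text \<open>Substitutivity (\<open>Q4\<close>) is applied to the formula saying that the two
  quasi-cardinals have the same elements; with \<open>y\<close> replaced by \<open>x\<close> it is
  trivially true. Variable 9 is bound and distinct from the marked variables 0 and 1.\<close>

lemma qc_cong:
  assumes "Q x" "Q y" "x =\<^sub>E y"
  shows "qc x =\<^sub>E qc y"
proof (rule extI[OF qc_Q[OF assms(1)] qc_Q[OF assms(2)]])
  show "z \<epsilon> qc x \<longleftrightarrow> z \<epsilon> qc y" for z
    using Q4[where i=0 and j=1 and e="\<lambda>_. x" and x=x and y=y
        and A="Forall 9 (Iff (Member (Var 9) (QC (Var 0))) (Member (Var 9) (QC (Var 1))))"] assms(3)
    by auto
qed

text \<open>A qset without elements need not be the chosen representative \<open>empty\<close>; it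
  is only \<open>=\<^sub>E\<close> to it, so the value is carried over by
  \<open>qc_cong\<close>.\<close>

lemma qc_empty_zero:
  assumes "Q x" "\<And>t. \<not> t \<epsilon> x"
  shows "qc x =\<^sub>E zero"
  using eq_trans[OF qc_cong[OF assms(1) empty_mem(1) eq_zeroI[OF assms]] qc_empty] .

text \<open>Needed to apply \<open>Q21\<close> with the cardinal \<open>one\<close>. All elements of
  \<open>one\<close> are empty and \<open>=\<^sub>E\<close> to each other: the order conditions
  become trivial, and no element can be mapped onto the nonempty \<open>one\<close>.\<close>

lemma cardinal_one: "cardinal one"
proof -
  have "ordinal one" unfolding ordinal_def
  proof (intro conjI allI impI)
    show "Z one" by (rule Z_one)
    show "Z x" if "x \<epsilon> one" for x
      using that one_mem(2) Q9_Z eq_sym Z_empty by blast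
    show "x \<epsilon> y \<or> x =\<^sub>E y \<or> y \<epsilon> x" if "x \<epsilon> one \<and> y \<epsilon> one" for x y
      using that one_mem(2) eq_trans eq_sym by blast
    fix s assume s: "Z s \<and> s \<sqsubseteq> one \<and> \<not> s =\<^sub>E zero"
    then obtain x where "x \<epsilon> s" using eq_zeroI[OF Q7] by blast
    moreover have "x =\<^sub>E y" if "y \<epsilon> s" for y
      using s \<open>x \<epsilon> s\<close> that one_mem(2) eq_trans eq_sym unfolding sub_def by blast
    ultimately show "\<exists>x. x \<epsilon> s \<and> (\<forall>y. y \<epsilon> s \<longrightarrow> x =\<^sub>E y \<or> x \<epsilon> y)" by blast
  qed (auto simp: sub_def dest: mem_one_empty)
  moreover have "\<not> equinum a one" if "a \<epsilon> one" for a
    using equinum_empty[of a one] mem_one_empty[OF that] zero_in_one by blast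
  ultimately show ?thesis by (simp add: cardinal_def)
qed

end

context quasi_set_theory
begin

lemma Power_mem: "Q x \<Longrightarrow> Q (Power x)" "Q x \<Longrightarrow> t \<epsilon> Power x \<longleftrightarrow> Q t \<and> t \<sqsubseteq> x"
  using comprI[OF Q15[of x]] by (auto simp: Power_def)

text \<open>Separation accepts only formulas of the language, so \<open>u\<close> enters as a
  parameter, the value of \<open>Var 1\<close>, while \<open>Var 0\<close> stands for the tested
  qset.\<close>

lemma S_of_mem: "Q (S_of u)" "s \<epsilon> S_of u \<longleftrightarrow> Q s \<and> s \<sqsubseteq> single u \<and> u \<epsilon> s"
  using sep_mem[OF Power_mem(1)[OF single_mem(1)], of "\<lambda>s. u \<epsilon> s" "\<lambda>_. u" 0 "Member (Var 1) (Var 0)"]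
    Power_mem(2)[OF single_mem(1)]
  by (auto simp: S_of_def)

lemma Inter_of_mem:
  assumes "E x"
  shows "Q (Inter_of x)"
    and "z \<epsilon> Inter_of x \<longleftrightarrow> (\<exists>t. z \<epsilon> t \<and> t \<epsilon> x) \<and> (\<forall>s. s \<epsilon> x \<longrightarrow> z \<epsilon> s)"
proof -
  have "Q x" using assms by (simp add: E_def)
  then have U: "Q (Union_of x)" "\<And>z. z \<epsilon> Union_of x \<longleftrightarrow> (\<exists>t. z \<epsilon> t \<and> t \<epsilon> x)"
    using comprI[OF Q14[OF _ assms]] by (auto simp: Union_of_def)
  show "Q (Inter_of x)"
    and "z \<epsilon> Inter_of x \<longleftrightarrow> (\<exists>t. z \<epsilon> t \<and> t \<epsilon> x) \<and> (\<forall>s. s \<epsilon> x \<longrightarrow> z \<epsilon> s)"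
    using sep_mem[OF U(1), of "\<lambda>z. \<forall>s. s \<epsilon> x \<longrightarrow> z \<epsilon> s" "\<lambda>_. x" 0
        "Forall 2 (Imp (Member (Var 2) (Var 1)) (Member (Var 0) (Var 2)))"] U(2)
    by (auto simp: Inter_of_def)
qed

lemma star_Q: "Q (star u)"
  and self_mem_star: "u \<epsilon> star u"
  and star_sub_single: "star u \<sqsubseteq> single u"
  and star_least: "Q x \<Longrightarrow> x \<sqsubseteq> single u \<Longrightarrow> u \<epsilon> x \<Longrightarrow> star u \<sqsubseteq> x"
proof -
  \<comment> \<open>The union axiom requires every element to be a qset; the guard
    \<open>Q t\<close> in \<open>Power\<close> ensures this.\<close>
  have E: "E (S_of u)" by (simp add: E_def S_of_mem)
  \<comment> \<open>This member of \<open>S_of u\<close> bounds the intersection by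
    \<open>single u\<close> and puts \<open>u\<close> into the union from which the intersection is
    separated.\<close>
  have "single u \<epsilon> S_of u" by (simp add: S_of_mem single_mem Q1 sub_def)
  then show "Q (star u)" "u \<epsilon> star u" "star u \<sqsubseteq> single u"
    "Q x \<Longrightarrow> x \<sqsubseteq> single u \<Longrightarrow> u \<epsilon> x \<Longrightarrow> star u \<sqsubseteq> x"
    using Inter_of_mem[OF E] S_of_mem(2) by (auto simp: star_def sub_def)
qed

lemma qc_star: "qc (star u) =\<^sub>E one"
proof -
  have "\<not> star u =\<^sub>E zero" using not_mem_eq_zero self_mem_star by blast
  then have "card_le one (qc (star u))"
    using one_card_le Q20[OF star_Q] Q19[OF star_Q] by (auto simp: cardinal_def)
  then obtain y where y: "Q y" "y \<sqsubseteq> star u" "qc y =\<^sub>E one"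
    using Q21[OF star_Q cardinal_one] by blast
  have "u \<epsilon> y"
  proof (rule ccontr)
    assume "\<not> u \<epsilon> y"
    \<comment> \<open>Elements of \<open>y\<close> are merely indistinguishable from
      \<open>u\<close>, which does not by itself put \<open>u\<close> in \<open>y\<close>. If
      \<open>u\<close> is missing, the complement of \<open>y\<close> in \<open>single u\<close>
      contains \<open>u\<close>, so minimality of \<open>star u\<close> applies to it.\<close>
    let ?c = "sep (single u) (\<lambda>t. \<not> t \<epsilon> y)"
    have c: "Q ?c" "\<And>t. t \<epsilon> ?c \<longleftrightarrow> t \<epsilon> single u \<and> \<not> t \<epsilon> y"
      using sep_mem[OF single_mem(1), of "\<lambda>t. \<not> t \<epsilon> y" "\<lambda>_. y" 0 "Neg (Member (Var 0) (Var 1))"]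
      by auto
    have "star u \<sqsubseteq> ?c"
      using c \<open>\<not> u \<epsilon> y\<close> by (intro star_least) (auto simp: sub_def single_mem Q1)
    \<comment> \<open>\<open>y\<close> lies in \<open>star u\<close>, hence in its own complement,
      so it is empty.\<close>
    then have "\<not> t \<epsilon> y" for t using y(2) c(2) by (auto simp: sub_def)
    then have "one =\<^sub>E zero"
      using eq_trans[OF eq_sym[OF y(3)] qc_empty_zero[OF y(1)]] by blast
    then show False using one_neq_zero by blast
  qed
  then have "star u \<sqsubseteq> y"
    using star_least[OF y(1)] y(2) star_sub_single by (auto simp: sub_def)
  then have "star u =\<^sub>E y" using y(2) by (intro extI star_Q y(1)) (auto simp: sub_def)
  then show ?thesis using eq_trans[OF qc_cong[OF star_Q y(1)] y(3)] by blast
qed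

end

theorem theorem10:
  fixes S :: "'a quasi_struct" and u :: 'a
  assumes "quasi_set_theory S"
    and "m_atom S u"
  shows "quasi_structure.ext_eq S (qcard S (quasi_structure.star S u)) (quasi_structure.one S)"
  using quasi_set_theory.qc_star[OF assms(1)] .

end
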